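(* Let $p$ be an odd prime. Then $H_\omega(p)$ can be built over the Rado graph $\mathcal{R}$; that is, there is a subset $X\subseteq H_\omega(p)$ such that (1) $X$ is a union of conjugacy classes of $H_\omega(p)$; (2) $\tilde{\Gamma}(X)$ and $\mathcal{R}$ are isomorphic as graphs; (3) $H_\omega(p)$ is equal to its subgroup generated by $X\cup Z(H_\omega(p))$.
   Context: $H_\omega(p)$ (also written $H_\infty(p)$) is the countably infinite Heisenberg group: the set of $[x,y,z]$ with $z\in\mathbb{F}_p$ and $x,y$ infinite sequences of elements of $\mathbb{F}_p$ with at most finitely many nonzero entries, with product $[x,y,z][x',y',z'] = [x+x', y+y', z+z'+x\cdot y']$, where $x\cdot y' = \sum_i x_iy'_i$. $Z(H)$ denotes the center of $H$. $\tilde{\Gamma}(H_\omega(p))$ is the graph whose vertices are the non-central conjugacy classes $C_{x,y}=\{[x,y,z]: z\in\mathbb{F}_p\}$, $(x,y)\neq(0,0)$, with an edge between two distinct classes $C_{x,y}$ and $C_{a,b}$ if and only if their elements commute, i.e. $x\cdot b - a\cdot y = 0$ (loops are ignored). For $X$ a union of conjugacy classes, $\tilde\Gamma(X)$ is the induced subgraph of $\tilde\Gamma(H_\omega(p))$ on the classes contained in $X$. The Rado (random) graph $\mathcal{R}$ is the unique (up to isomorphism) countably infinite graph such that for any two disjoint finite sets $U,W$ of vertices there is a vertex outside $U\cup W$ adjacent to all of $U$ and to none of $W$. *)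

theory Defs
  imports "HOL-Algebra.Group_Action" "HOL-Algebra.Generated_Groups" "HOL-Number_Theory.Residues"
    "HOL-Library.Countable_Set"
begin

section \<open>Simple graphs and the Rado graph\<close>

record 'v ugraph =
  vertices :: "'v set"
  edges :: "'v set set"

definition simple_graph :: "'v ugraph \<Rightarrow> bool" where
  "simple_graph G \<longleftrightarrow>
     (\<forall>e\<in>edges G. \<exists>u\<in>vertices G. \<exists>v\<in>vertices G. u \<noteq> v \<and> e = {u, v})"

definition adjacent :: "'v ugraph \<Rightarrow> 'v \<Rightarrow> 'v \<Rightarrow> bool" where
  "adjacent G u v \<longleftrightarrow> {u, v} \<in> edges G"

definition graph_isomorphic :: "'v ugraph \<Rightarrow> 'w ugraph \<Rightarrow> bool" where
  "graph_isomorphic G H \<longleftrightarrow>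
     (\<exists>f. bij_betw f (vertices G) (vertices H) \<and>
          (\<forall>u\<in>vertices G. \<forall>v\<in>vertices G. adjacent G u v \<longleftrightarrow> adjacent H (f u) (f v)))"

definition induced_subgraph :: "'v ugraph \<Rightarrow> 'v set \<Rightarrow> 'v ugraph" where
  "induced_subgraph G S =
     \<lparr>vertices = vertices G \<inter> S, edges = {e \<in> edges G. e \<subseteq> S}\<rparr>"

text \<open>
  The Rado graph is determined by the following property only up to isomorphism, so it is rendered
  as a predicate; lemma \<open>rado_graph_exists\<close> below shows that the predicate is satisfiable.
\<close>

definition rado_graph :: "'v ugraph \<Rightarrow> bool" where
  "rado_graph G \<longleftrightarrow>
     simple_graph G \<and> infinite (vertices G) \<and> countable (vertices G) \<and>
     (\<forall>U W. finite U \<and> finite W \<and> U \<subseteq> vertices G \<and> W \<subseteq> vertices G \<and> U \<inter> W = {} \<longrightarrow>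
        (\<exists>v\<in>vertices G - (U \<union> W). (\<forall>u\<in>U. adjacent G v u) \<and> (\<forall>w\<in>W. \<not> adjacent G v w)))"


section \<open>Conjugacy classes and the commuting graph of a group\<close>

definition group_center :: "('a, 'b) monoid_scheme \<Rightarrow> 'a set" where
  "group_center G = {z \<in> carrier G. \<forall>g\<in>carrier G. z \<otimes>\<^bsub>G\<^esub> g = g \<otimes>\<^bsub>G\<^esub> z}"

definition conjugacy_classes :: "('a, 'b) monoid_scheme \<Rightarrow> 'a set set" where
  "conjugacy_classes G =
     orbits G (carrier G) (\<lambda>g. \<lambda>h\<in>carrier G. g \<otimes>\<^bsub>G\<^esub> h \<otimes>\<^bsub>G\<^esub> inv\<^bsub>G\<^esub> g)"

definition noncentral_classes :: "('a, 'b) monoid_scheme \<Rightarrow> 'a set set" where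
  "noncentral_classes G = {C \<in> conjugacy_classes G. \<not> C \<subseteq> group_center G}"

text \<open>
  In the Heisenberg group it does not matter whether all or some representatives are required to
  commute; see lemma \<open>heisenberg_commute_iff\<close> below.
\<close>

definition class_graph :: "('a, 'b) monoid_scheme \<Rightarrow> 'a set ugraph" where
  "class_graph G =
     \<lparr>vertices = noncentral_classes G,
      edges = {{C, D} | C D. C \<in> noncentral_classes G \<and> D \<in> noncentral_classes G \<and> C \<noteq> D \<and>
                 (\<forall>c\<in>C. \<forall>d\<in>D. c \<otimes>\<^bsub>G\<^esub> d = d \<otimes>\<^bsub>G\<^esub> c)}\<rparr>"

definition class_subgraph :: "('a, 'b) monoid_scheme \<Rightarrow> 'a set \<Rightarrow> 'a set ugraph" where
  "class_subgraph G S = induced_subgraph (class_graph G) {C. C \<subseteq> S}"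

definition union_of_classes :: "('a, 'b) monoid_scheme \<Rightarrow> 'a set \<Rightarrow> bool" where
  "union_of_classes G S \<longleftrightarrow> (\<exists>K\<subseteq>conjugacy_classes G. S = \<Union>K)"


section \<open>The infinite Heisenberg group\<close>

definition fin_seqs :: "('a, 'b) ring_scheme \<Rightarrow> (nat \<Rightarrow> 'a) set" where
  "fin_seqs R = {x. (\<forall>i. x i \<in> carrier R) \<and> finite {i. x i \<noteq> \<zero>\<^bsub>R\<^esub>}}"

text \<open>The sum runs over the support of \<open>x\<close> because \<open>finsum\<close> over an infinite set is zero.\<close>

definition dot :: "('a, 'b) ring_scheme \<Rightarrow> (nat \<Rightarrow> 'a) \<Rightarrow> (nat \<Rightarrow> 'a) \<Rightarrow> 'a" where
  "dot R x y = finsum R (\<lambda>i. x i \<otimes>\<^bsub>R\<^esub> y i) {i. x i \<noteq> \<zero>\<^bsub>R\<^esub>}"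

definition heisenberg_over ::
    "('a, 'b) ring_scheme \<Rightarrow> ((nat \<Rightarrow> 'a) \<times> (nat \<Rightarrow> 'a) \<times> 'a) monoid" where
  "heisenberg_over R =
     \<lparr>carrier = fin_seqs R \<times> fin_seqs R \<times> carrier R,
      monoid.mult = (\<lambda>(x, y, z) (x', y', z').
        (\<lambda>i. x i \<oplus>\<^bsub>R\<^esub> x' i, \<lambda>i. y i \<oplus>\<^bsub>R\<^esub> y' i, z \<oplus>\<^bsub>R\<^esub> z' \<oplus>\<^bsub>R\<^esub> dot R x y')),
      one = (\<lambda>i. \<zero>\<^bsub>R\<^esub>, \<lambda>i. \<zero>\<^bsub>R\<^esub>, \<zero>\<^bsub>R\<^esub>)\<rparr>"

definition heisenberg :: "nat \<Rightarrow> ((nat \<Rightarrow> int) \<times> (nat \<Rightarrow> int) \<times> int) monoid" where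
  "heisenberg p = heisenberg_over (residue_ring (int p))"


section \<open>The definitions agree with the explicit description\<close>

lemma rado_graph_exists: "\<exists>G :: nat ugraph. rado_graph G"
proof -
  define G :: "nat ugraph" where
    "G = \<lparr>vertices = UNIV, edges = {{u, v} | u v. u < v \<and> bit v u}\<rparr>"
  have big: "u < v" if "bit v u" for u v :: nat
  proof -
    have "v div 2 ^ u \<noteq> 0" using that by (metis bit_iff_odd even_zero)
    then have "2 ^ u \<le> v" by (simp add: div_eq_0_iff)
    then show ?thesis using less_exp[of u] by linarith
  qed
  have adj: "adjacent G v u \<longleftrightarrow> bit v u \<or> bit u v" for u v
  proof -
    have "adjacent G v u \<longleftrightarrow> (v < u \<and> bit u v) \<or> (u < v \<and> bit v u)"
      unfolding adjacent_def G_def by (auto simp: doubleton_eq_iff)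
    then show ?thesis using big by blast
  qed
  have simp: "simple_graph G"
    unfolding simple_graph_def
  proof
    fix e assume "e \<in> edges G"
    then obtain u v where "e = {u, v}" "u < v" by (auto simp: G_def)
    then show "\<exists>u\<in>vertices G. \<exists>v\<in>vertices G. u \<noteq> v \<and> e = {u, v}"
      by (intro bexI[of _ u] bexI[of _ v]) (auto simp: G_def)
  qed
  have ext: "\<exists>v. v \<notin> U \<union> W \<and> (\<forall>u\<in>U. adjacent G v u) \<and> (\<forall>w\<in>W. \<not> adjacent G v w)"
    if UW: "finite U" "finite W" "U \<inter> W = {}" for U W :: "nat set"
  proof -
    define N where "N = Suc (\<Sum>(U \<union> W))"
    have N: "u < N" if "u \<in> U \<union> W" for u
    proof -
      have "u \<le> \<Sum>(U \<union> W)"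
        by (rule member_le_sum[of u "U \<union> W" "\<lambda>x. x"]) (use that UW in auto)
      then show ?thesis by (simp add: N_def)
    qed
    define v where "v = set_encode (insert N U)"
    have bv: "bit v i \<longleftrightarrow> i \<in> insert N U" for i
      using set_encode_inverse[of "insert N U"] UW
      by (simp add: v_def set_decode_def bit_iff_odd set_eq_iff)
    have Nv: "N < v" using bv big by blast
    have "v \<notin> U \<union> W" using N Nv by fastforce
    moreover have "\<forall>u\<in>U. adjacent G v u" using adj bv by auto
    moreover have "\<not> adjacent G v w" if "w \<in> W" for w
    proof -
      have "w < N" using N that by auto
      then have "\<not> bit v w" using bv UW that by auto
      moreover have "\<not> bit w v" using big[of w v] \<open>w < N\<close> Nv by auto
      ultimately show ?thesis using adj by simp
    qed
    ultimately show ?thesis by blast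
  qed
  have "rado_graph G"
    unfolding rado_graph_def
  proof (intro conjI allI impI)
    show "simple_graph G" by (fact simp)
    show "infinite (vertices G)" "countable (vertices G)" by (simp_all add: G_def)
    fix U W
    assume "finite U \<and> finite W \<and> U \<subseteq> vertices G \<and> W \<subseteq> vertices G \<and> U \<inter> W = {}"
    then show "\<exists>v\<in>vertices G - (U \<union> W). (\<forall>u\<in>U. adjacent G v u) \<and> (\<forall>w\<in>W. \<not> adjacent G v w)"
      using ext[of U W] by (auto simp: G_def)
  qed
  then show ?thesis by blast
qed

context cring
begin

lemma fin_seqsD: "x \<in> fin_seqs R \<Longrightarrow> x i \<in> carrier R"
  by (simp add: fin_seqs_def)

lemma zero_fin_seqs: "(\<lambda>i. \<zero>) \<in> fin_seqs R"
  by (simp add: fin_seqs_def)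

lemma add_fin_seqs:
  assumes "x \<in> fin_seqs R" "y \<in> fin_seqs R"
  shows "(\<lambda>i. x i \<oplus> y i) \<in> fin_seqs R"
proof -
  have "{i. x i \<oplus> y i \<noteq> \<zero>} \<subseteq> {i. x i \<noteq> \<zero>} \<union> {i. y i \<noteq> \<zero>}" by auto
  then show ?thesis
    using assms unfolding fin_seqs_def by (auto intro: finite_subset)
qed

lemma uminus_fin_seqs:
  assumes "x \<in> fin_seqs R"
  shows "(\<lambda>i. \<ominus> x i) \<in> fin_seqs R"
proof -
  have "{i. \<ominus> x i \<noteq> \<zero>} \<subseteq> {i. x i \<noteq> \<zero>}" by auto
  then show ?thesis
    using assms unfolding fin_seqs_def by (auto intro: finite_subset)
qed

lemma dot_superset:
  assumes "x \<in> fin_seqs R" "y \<in> fin_seqs R" "finite A" "{i. x i \<noteq> \<zero>} \<subseteq> A"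
  shows "dot R x y = (\<Oplus>i\<in>A. x i \<otimes> y i)"
  unfolding dot_def
  by (rule add.finprod_mono_neutral_cong_left) (use assms in \<open>auto simp: fin_seqs_def\<close>)

lemma dot_closed:
  assumes "x \<in> fin_seqs R" "y \<in> fin_seqs R"
  shows "dot R x y \<in> carrier R"
  unfolding dot_def by (rule finsum_closed) (use assms in \<open>auto simp: fin_seqs_def\<close>)

lemma dot_add_left:
  assumes "x \<in> fin_seqs R" "x' \<in> fin_seqs R" "y \<in> fin_seqs R"
  shows "dot R (\<lambda>i. x i \<oplus> x' i) y = dot R x y \<oplus> dot R x' y"
proof -
  let ?A = "{i. x i \<noteq> \<zero>} \<union> {i. x' i \<noteq> \<zero>}"
  have A: "finite ?A" using assms by (simp add: fin_seqs_def)
  have "dot R (\<lambda>i. x i \<oplus> x' i) y = (\<Oplus>i\<in>?A. (x i \<oplus> x' i) \<otimes> y i)"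
    by (rule dot_superset) (use assms A add_fin_seqs in auto)
  also have "\<dots> = (\<Oplus>i\<in>?A. x i \<otimes> y i \<oplus> x' i \<otimes> y i)"
    by (rule finsum_cong') (use assms in \<open>auto simp: fin_seqs_def l_distr\<close>)
  also have "\<dots> = (\<Oplus>i\<in>?A. x i \<otimes> y i) \<oplus> (\<Oplus>i\<in>?A. x' i \<otimes> y i)"
    by (rule finsum_addf) (use assms in \<open>auto simp: fin_seqs_def\<close>)
  also have "(\<Oplus>i\<in>?A. x i \<otimes> y i) = dot R x y"
    by (rule dot_superset[symmetric]) (use assms A in auto)
  also have "(\<Oplus>i\<in>?A. x' i \<otimes> y i) = dot R x' y"
    by (rule dot_superset[symmetric]) (use assms A in auto)
  finally show ?thesis .
qed

lemma dot_commute: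
  assumes "x \<in> fin_seqs R" "y \<in> fin_seqs R"
  shows "dot R x y = dot R y x"
proof -
  let ?A = "{i. x i \<noteq> \<zero>} \<union> {i. y i \<noteq> \<zero>}"
  have A: "finite ?A" using assms by (simp add: fin_seqs_def)
  have "dot R x y = (\<Oplus>i\<in>?A. x i \<otimes> y i)"
    by (rule dot_superset) (use assms A in auto)
  also have "\<dots> = (\<Oplus>i\<in>?A. y i \<otimes> x i)"
    by (rule finsum_cong') (use assms in \<open>auto simp: fin_seqs_def m_comm\<close>)
  also have "\<dots> = dot R y x"
    by (rule dot_superset[symmetric]) (use assms A in auto)
  finally show ?thesis .
qed

lemma dot_add_right:
  assumes "x \<in> fin_seqs R" "y \<in> fin_seqs R" "y' \<in> fin_seqs R"
  shows "dot R x (\<lambda>i. y i \<oplus> y' i) = dot R x y \<oplus> dot R x y'"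
  using assms dot_add_left[of y y' x] by (simp add: dot_commute[of x] add_fin_seqs)

lemma dot_zero_left [simp]: "dot R (\<lambda>i. \<zero>) y = \<zero>"
  by (simp add: dot_def)

lemma dot_zero_right [simp]: "x \<in> fin_seqs R \<Longrightarrow> dot R x (\<lambda>i. \<zero>) = \<zero>"
  by (simp add: dot_commute[OF _ zero_fin_seqs])

lemma dot_uminus_left:
  assumes "x \<in> fin_seqs R" "y \<in> fin_seqs R"
  shows "dot R (\<lambda>i. \<ominus> x i) y = \<ominus> dot R x y"
proof -
  have "dot R (\<lambda>i. \<ominus> x i) y \<oplus> dot R x y = dot R (\<lambda>i. \<ominus> x i \<oplus> x i) y"
    using assms by (simp add: dot_add_left uminus_fin_seqs)
  also have "(\<lambda>i. \<ominus> x i \<oplus> x i) = (\<lambda>i. \<zero>)"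
    using assms by (simp add: fin_seqsD l_neg)
  finally show ?thesis
    using assms by (intro minus_equality[symmetric]) (auto simp: dot_closed uminus_fin_seqs)
qed

lemma dot_uminus_right:
  assumes "x \<in> fin_seqs R" "y \<in> fin_seqs R"
  shows "dot R x (\<lambda>i. \<ominus> y i) = \<ominus> dot R x y"
  using assms dot_uminus_left[of y x] by (simp add: dot_commute[of x] uminus_fin_seqs)

lemma dot_unit:
  assumes "x \<in> fin_seqs R" "c \<in> carrier R"
  shows "(\<lambda>i. if i = k then c else \<zero>) \<in> fin_seqs R"
    and "dot R (\<lambda>i. if i = k then c else \<zero>) x = c \<otimes> x k"
proof -
  let ?e = "\<lambda>i. if i = k then c else \<zero>"
  show e: "?e \<in> fin_seqs R"
    using assms by (auto simp: fin_seqs_def intro: finite_subset[of _ "{k}"])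
  have "dot R ?e x = (\<Oplus>i\<in>{k}. ?e i \<otimes> x i)"
    by (rule dot_superset) (use assms e in auto)
  also have "\<dots> = c \<otimes> x k"
    using assms by (simp add: fin_seqsD)
  finally show "dot R ?e x = c \<otimes> x k" .
qed

lemma heisenberg_carrier:
  "(x, y, z) \<in> carrier (heisenberg_over R) \<longleftrightarrow>
     x \<in> fin_seqs R \<and> y \<in> fin_seqs R \<and> z \<in> carrier R"
  by (simp add: heisenberg_over_def)

lemma heisenberg_mult:
  "(x, y, z) \<otimes>\<^bsub>heisenberg_over R\<^esub> (x', y', z') =
     (\<lambda>i. x i \<oplus> x' i, \<lambda>i. y i \<oplus> y' i, z \<oplus> z' \<oplus> dot R x y')"
  by (simp add: heisenberg_over_def)

lemma heisenberg_group: "group (heisenberg_over R)"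
proof (rule groupI)
  fix g h assume "g \<in> carrier (heisenberg_over R)" "h \<in> carrier (heisenberg_over R)"
  then show "g \<otimes>\<^bsub>heisenberg_over R\<^esub> h \<in> carrier (heisenberg_over R)"
    by (cases g; cases h) (simp add: heisenberg_carrier heisenberg_mult add_fin_seqs dot_closed)
next
  show "\<one>\<^bsub>heisenberg_over R\<^esub> \<in> carrier (heisenberg_over R)"
    by (simp add: heisenberg_over_def zero_fin_seqs)
next
  fix g h k
  assume "g \<in> carrier (heisenberg_over R)" "h \<in> carrier (heisenberg_over R)"
    "k \<in> carrier (heisenberg_over R)"
  then show "g \<otimes>\<^bsub>heisenberg_over R\<^esub> h \<otimes>\<^bsub>heisenberg_over R\<^esub> k =
      g \<otimes>\<^bsub>heisenberg_over R\<^esub> (h \<otimes>\<^bsub>heisenberg_over R\<^esub> k)"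
    by (cases g; cases h; cases k)
      (simp add: heisenberg_carrier heisenberg_mult add_fin_seqs dot_closed dot_add_left
        dot_add_right fin_seqsD a_ac)
next
  fix g assume "g \<in> carrier (heisenberg_over R)"
  then show "\<one>\<^bsub>heisenberg_over R\<^esub> \<otimes>\<^bsub>heisenberg_over R\<^esub> g = g"
    by (cases g) (simp add: heisenberg_over_def fin_seqsD)
next
  fix g assume "g \<in> carrier (heisenberg_over R)"
  then obtain x y z where g: "g = (x, y, z)" "x \<in> fin_seqs R" "y \<in> fin_seqs R" "z \<in> carrier R"
    by (cases g) (simp add: heisenberg_carrier)
  let ?h = "(\<lambda>i. \<ominus> x i, \<lambda>i. \<ominus> y i, \<ominus> z \<oplus> dot R x y)"
  have "\<ominus> z \<oplus> dot R x y \<oplus> z \<oplus> \<ominus> dot R x y = \<zero>"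
    using g dot_closed[of x y] by algebra
  then have "?h \<otimes>\<^bsub>heisenberg_over R\<^esub> g = \<one>\<^bsub>heisenberg_over R\<^esub>"
    using g by (simp add: heisenberg_mult dot_uminus_left fin_seqsD l_neg)
      (simp add: heisenberg_over_def)
  moreover have "?h \<in> carrier (heisenberg_over R)"
    using g by (simp add: heisenberg_carrier uminus_fin_seqs dot_closed)
  ultimately show "\<exists>h\<in>carrier (heisenberg_over R).
      h \<otimes>\<^bsub>heisenberg_over R\<^esub> g = \<one>\<^bsub>heisenberg_over R\<^esub>" by blast
qed

lemma heisenberg_commute_iff:
  assumes "x \<in> fin_seqs R" "y \<in> fin_seqs R" "z \<in> carrier R"
    and "a \<in> fin_seqs R" "b \<in> fin_seqs R" "c \<in> carrier R"
  shows "(x, y, z) \<otimes>\<^bsub>heisenberg_over R\<^esub> (a, b, c) = (a, b, c) \<otimes>\<^bsub>heisenberg_over R\<^esub> (x, y, z) \<longleftrightarrow>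
     dot R x b \<ominus> dot R a y = \<zero>"
proof -
  have cl: "dot R x b \<in> carrier R" "dot R a y \<in> carrier R"
    using assms by (auto simp: dot_closed)
  have "z \<oplus> c \<oplus> dot R x b = c \<oplus> z \<oplus> dot R a y \<longleftrightarrow> dot R x b = dot R a y"
    using assms cl by (simp add: a_comm[of c z])
  also have "\<dots> \<longleftrightarrow> dot R x b \<ominus> dot R a y = \<zero>"
    using cl by simp
  finally show ?thesis
    using assms by (auto simp: heisenberg_mult a_comm fin_seqsD)
qed

end

context field
begin

lemma heisenberg_center:
  "group_center (heisenberg_over R) = {(\<lambda>i. \<zero>, \<lambda>i. \<zero>, z) | z. z \<in> carrier R}"
proof (intro equalityI subsetI)
  fix g assume "g \<in> group_center (heisenberg_over R)"
  then obtain x y z where g: "g = (x, y, z)" "x \<in> fin_seqs R" "y \<in> fin_seqs R" "z \<in> carrier R"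
    and c: "\<And>h. h \<in> carrier (heisenberg_over R) \<Longrightarrow>
      g \<otimes>\<^bsub>heisenberg_over R\<^esub> h = h \<otimes>\<^bsub>heisenberg_over R\<^esub> g"
    by (cases g) (auto simp: group_center_def heisenberg_carrier)
  have *: "dot R x b \<ominus> dot R a y = \<zero>" if "a \<in> fin_seqs R" "b \<in> fin_seqs R" for a b
    using c[of "(a, b, \<zero>)"] g that heisenberg_commute_iff[of x y z a b \<zero>]
    by (simp add: heisenberg_carrier)
  have "x k = \<zero>" for k
  proof -
    let ?e = "\<lambda>i. if i = k then \<one> else \<zero>"
    have "dot R x ?e = x k"
      using dot_unit[of x \<one> k] g by (simp add: dot_commute[of x] fin_seqsD)
    then show ?thesis
      using *[OF zero_fin_seqs, of ?e] dot_unit[of x \<one> k] g by (simp add: fin_seqsD)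
  qed
  moreover have "y k = \<zero>" for k
  proof -
    let ?e = "\<lambda>i. if i = k then \<one> else \<zero>"
    have "dot R ?e y = y k"
      using dot_unit[of y \<one> k] g by (simp add: fin_seqsD)
    then show ?thesis
      using *[OF _ zero_fin_seqs, of ?e] dot_unit[of y \<one> k] g by (simp add: fin_seqsD)
  qed
  ultimately show "g \<in> {(\<lambda>i::nat. \<zero>, \<lambda>i::nat. \<zero>, z) | z. z \<in> carrier R}"
    using g by auto
next
  fix g assume "g \<in> {(\<lambda>i::nat. \<zero>, \<lambda>i::nat. \<zero>, z) | z. z \<in> carrier R}"
  then obtain z where g: "g = (\<lambda>i. \<zero>, \<lambda>i. \<zero>, z)" "z \<in> carrier R" by auto
  show "g \<in> group_center (heisenberg_over R)"
    unfolding group_center_def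
  proof (intro CollectI conjI ballI)
    show "g \<in> carrier (heisenberg_over R)"
      using g by (simp add: heisenberg_carrier zero_fin_seqs)
    fix h assume "h \<in> carrier (heisenberg_over R)"
    then show "g \<otimes>\<^bsub>heisenberg_over R\<^esub> h = h \<otimes>\<^bsub>heisenberg_over R\<^esub> g"
      using g by (cases h) (simp add: heisenberg_carrier heisenberg_commute_iff zero_fin_seqs)
  qed
qed

lemma heisenberg_conjugate:
  assumes "x \<in> fin_seqs R" "y \<in> fin_seqs R" "z \<in> carrier R"
    and "a \<in> fin_seqs R" "b \<in> fin_seqs R" "c \<in> carrier R"
  shows "(a, b, c) \<otimes>\<^bsub>heisenberg_over R\<^esub> (x, y, z) \<otimes>\<^bsub>heisenberg_over R\<^esub>
     inv\<^bsub>heisenberg_over R\<^esub> (a, b, c) = (x, y, z \<oplus> (dot R a y \<ominus> dot R x b))"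
proof -
  interpret H: group "heisenberg_over R" by (rule heisenberg_group)
  have cl: "dot R x b \<in> carrier R" "dot R a y \<in> carrier R" "dot R a b \<in> carrier R"
    using assms by (auto simp: dot_closed)
  have "c \<oplus> z \<oplus> dot R a y = z \<oplus> (dot R a y \<ominus> dot R x b) \<oplus> c \<oplus> dot R x b"
    using assms cl by algebra
  then have "(a, b, c) \<otimes>\<^bsub>heisenberg_over R\<^esub> (x, y, z) =
      (x, y, z \<oplus> (dot R a y \<ominus> dot R x b)) \<otimes>\<^bsub>heisenberg_over R\<^esub> (a, b, c)"
    using assms cl by (auto simp: heisenberg_mult a_comm fin_seqsD)
  then show ?thesis
    using assms cl
    by (simp add: H.inv_solve_right' heisenberg_carrier heisenberg_mult add_fin_seqs)
qed

lemma heisenberg_noncentral_classes: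
  "noncentral_classes (heisenberg_over R) =
     {{(x, y, z) | z. z \<in> carrier R} | x y.
        x \<in> fin_seqs R \<and> y \<in> fin_seqs R \<and> (x, y) \<noteq> (\<lambda>i. \<zero>, \<lambda>i. \<zero>)}"
proof -
  let ?H = "heisenberg_over R"
  interpret H: group ?H by (rule heisenberg_group)
  define cl where "cl g = {h \<otimes>\<^bsub>?H\<^esub> g \<otimes>\<^bsub>?H\<^esub> inv\<^bsub>?H\<^esub> h | h. h \<in> carrier ?H}" for g
  have orb: "conjugacy_classes ?H = cl ` carrier ?H"
  proof -
    have "orbit ?H (\<lambda>g. \<lambda>h\<in>carrier ?H. g \<otimes>\<^bsub>?H\<^esub> h \<otimes>\<^bsub>?H\<^esub> inv\<^bsub>?H\<^esub> g) g = cl g"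
      if "g \<in> carrier ?H" for g
      using that by (simp add: orbit_def cl_def)
    then show ?thesis unfolding conjugacy_classes_def orbits_def image_def by (metis (lifting))
  qed
  have cl_sub: "cl (x, y, z) \<subseteq> {(x, y, z') | z'. z' \<in> carrier R}"
    if "x \<in> fin_seqs R" "y \<in> fin_seqs R" "z \<in> carrier R" for x y z
    using that by (auto simp: cl_def heisenberg_carrier heisenberg_conjugate dot_closed)
  have cl_eq: "cl (x, y, z) = {(x, y, z') | z'. z' \<in> carrier R}"
    if xyz: "x \<in> fin_seqs R" "y \<in> fin_seqs R" "z \<in> carrier R"
      and nz: "(x, y) \<noteq> (\<lambda>i. \<zero>, \<lambda>i. \<zero>)" for x y z
  proof (rule antisym[OF cl_sub[OF xyz]], rule subsetI)
    fix g assume "g \<in> {(x, y, z') | z'. z' \<in> carrier R}"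
    then obtain z' where g: "g = (x, y, z')" "z' \<in> carrier R" by auto
    have "\<exists>a\<in>fin_seqs R. \<exists>b\<in>fin_seqs R. dot R a y \<ominus> dot R x b = z' \<ominus> z"
    proof (cases "x = (\<lambda>i. \<zero>)")
      case True
      then obtain k where k: "y k \<noteq> \<zero>" using nz by auto
      let ?c = "(z' \<ominus> z) \<otimes> inv (y k)"
      have u: "y k \<in> Units R" using k xyz by (simp add: field_Units fin_seqsD)
      then have c: "?c \<in> carrier R" using g xyz by simp
      have "?c \<otimes> y k = z' \<ominus> z" using u g xyz by (simp add: m_assoc fin_seqsD)
      then show ?thesis
        using dot_unit[OF xyz(2) c, of k] True zero_fin_seqs g xyz
        by (intro bexI[of _ "\<lambda>i. if i = k then ?c else \<zero>"] bexI[of _ "\<lambda>i. \<zero>"])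
           (auto simp: minus_eq)
    next
      case False
      then obtain k where k: "x k \<noteq> \<zero>" by auto
      let ?c = "(z \<ominus> z') \<otimes> inv (x k)"
      have u: "x k \<in> Units R" using k xyz by (simp add: field_Units fin_seqsD)
      then have c: "?c \<in> carrier R" using g xyz by simp
      have e: "?c \<otimes> x k = z \<ominus> z'" using u g xyz by (simp add: m_assoc fin_seqsD)
      have "dot R x (\<lambda>i. if i = k then ?c else \<zero>) = z \<ominus> z'"
        using dot_unit[OF xyz(1) c, of k] e xyz by (simp add: dot_commute[of x])
      moreover have "\<zero> \<ominus> (z \<ominus> z') = z' \<ominus> z" using g xyz by algebra
      ultimately show ?thesis
        using dot_unit(1)[OF xyz(1) c, of k] zero_fin_seqs
        by (intro bexI[of _ "\<lambda>i. if i = k then ?c else \<zero>"] bexI[of _ "\<lambda>i. \<zero>"]) auto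
    qed
    then obtain a b where ab: "a \<in> fin_seqs R" "b \<in> fin_seqs R"
      "dot R a y \<ominus> dot R x b = z' \<ominus> z" by blast
    have "z \<oplus> (z' \<ominus> z) = z'" using g xyz by algebra
    then have "g = (a, b, \<zero>) \<otimes>\<^bsub>?H\<^esub> (x, y, z) \<otimes>\<^bsub>?H\<^esub> inv\<^bsub>?H\<^esub> (a, b, \<zero>)"
      using g xyz ab by (simp add: heisenberg_conjugate)
    then show "g \<in> cl (x, y, z)"
      unfolding cl_def using ab by (auto simp: heisenberg_carrier)
  qed
  show ?thesis
  proof (intro equalityI subsetI)
    fix C assume C: "C \<in> noncentral_classes ?H"
    then obtain g where g: "g \<in> carrier ?H" "C = cl g" and nc: "\<not> C \<subseteq> group_center ?H"
      unfolding noncentral_classes_def orb by blast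
    obtain x y z where "g = (x, y, z)" by (cases g)
    then have xyz: "x \<in> fin_seqs R" "y \<in> fin_seqs R" "z \<in> carrier R"
      and Cc: "C = cl (x, y, z)"
      using g by (simp_all add: heisenberg_carrier)
    have "(x, y) \<noteq> (\<lambda>i. \<zero>, \<lambda>i. \<zero>)"
      using nc cl_sub[OF xyz] Cc by (auto simp: heisenberg_center)
    then show "C \<in> {{(x, y, z) | z. z \<in> carrier R} | x y.
        x \<in> fin_seqs R \<and> y \<in> fin_seqs R \<and> (x, y) \<noteq> (\<lambda>i. \<zero>, \<lambda>i. \<zero>)}"
      using xyz cl_eq[OF xyz] Cc by blast
  next
    fix C assume "C \<in> {{(x, y, z) | z. z \<in> carrier R} | x y.
        x \<in> fin_seqs R \<and> y \<in> fin_seqs R \<and> (x, y) \<noteq> (\<lambda>i. \<zero>, \<lambda>i. \<zero>)}"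
    then obtain x y where xy: "x \<in> fin_seqs R" "y \<in> fin_seqs R" "(x, y) \<noteq> (\<lambda>i. \<zero>, \<lambda>i. \<zero>)"
      and C: "C = {(x, y, z) | z. z \<in> carrier R}" by blast
    have "C = cl (x, y, \<zero>)" using cl_eq[of x y \<zero>] xy C by simp
    then have "C \<in> conjugacy_classes ?H" using xy by (auto simp: orb heisenberg_carrier)
    moreover have "\<not> C \<subseteq> group_center ?H"
      using xy zero_closed unfolding heisenberg_center C by auto
    ultimately show "C \<in> noncentral_classes ?H" by (simp add: noncentral_classes_def)
  qed
qed

lemma heisenberg_class_graph_adjacent:
  fixes x y a b :: "nat \<Rightarrow> 'a"
  defines "C \<equiv> {(x, y, z) | z. z \<in> carrier R}" and "D \<equiv> {(a, b, z) | z. z \<in> carrier R}"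
  assumes xy: "x \<in> fin_seqs R" "y \<in> fin_seqs R" "(x, y) \<noteq> (\<lambda>i. \<zero>, \<lambda>i. \<zero>)"
    and ab: "a \<in> fin_seqs R" "b \<in> fin_seqs R" "(a, b) \<noteq> (\<lambda>i. \<zero>, \<lambda>i. \<zero>)"
  shows "adjacent (class_graph (heisenberg_over R)) C D \<longleftrightarrow>
    (x, y) \<noteq> (a, b) \<and> dot R x b \<ominus> dot R a y = \<zero>"
proof -
  let ?H = "heisenberg_over R"
  have mem: "C \<in> noncentral_classes ?H" "D \<in> noncentral_classes ?H"
    unfolding heisenberg_noncentral_classes C_def D_def using xy ab by blast+
  have ne: "C = D \<longleftrightarrow> (x, y) = (a, b)"
    unfolding C_def D_def using zero_closed by (auto simp: set_eq_iff)
  have "(\<forall>c\<in>C. \<forall>d\<in>D. c \<otimes>\<^bsub>?H\<^esub> d = d \<otimes>\<^bsub>?H\<^esub> c) \<longleftrightarrow> dot R x b \<ominus> dot R a y = \<zero>"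
    unfolding C_def D_def using xy ab zero_closed by (auto simp: heisenberg_commute_iff)
  moreover have "adjacent (class_graph ?H) C D \<longleftrightarrow>
      C \<noteq> D \<and> (\<forall>c\<in>C. \<forall>d\<in>D. c \<otimes>\<^bsub>?H\<^esub> d = d \<otimes>\<^bsub>?H\<^esub> c)"
    unfolding adjacent_def class_graph_def using mem by (auto simp: doubleton_eq_iff)
  ultimately show ?thesis using ne by simp
qed

end

end

theory Submission
  imports Defs
begin

text \<open>
  Two classes \<open>C\<^bsub>x,y\<^esub>\<close> and \<open>C\<^bsub>a,b\<^esub>\<close> commute iff the symplectic form
  \<open>\<omega>((x, y), (a, b)) = x \<cdot> b - a \<cdot> y\<close> vanishes, so the task is to label the vertices of the Rado
  graph injectively by nonzero vectors of the space of pairs of finitely supported sequences, in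
  such a way that \<open>\<omega>\<close> vanishes on two distinct labels exactly if they come from adjacent vertices,
  and that the labels span.

  The zero pattern alone could be realized for every countable graph; the extension property is what
  makes the labels span. It allows the vertices to be arranged into pairs
  \<open>a\<^sub>0, b\<^sub>0, a\<^sub>1, b\<^sub>1, \<dots>\<close> where \<open>b\<^sub>n\<close> is adjacent to everything before it except its partner \<open>a\<^sub>n\<close>
  (lemma \<open>rado_graph_pairing\<close>). These pairs behave like hyperbolic pairs: \<open>b\<^sub>n\<close> receives the basis
  vector \<open>(0, e\<^sub>n)\<close>, and \<open>a\<^sub>n\<close> receives a vector \<open>(c\<^sub>n, d\<^sub>n)\<close>. The relation of \<open>a\<^sub>n\<close> to the \<open>b\<^sub>i\<close>
  forces \<open>c\<^sub>n\<close> to be nonzero exactly at those \<open>i\<close> for which \<open>b\<^sub>i\<close> is not adjacent to \<open>a\<^sub>n\<close>; by the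
  choice of the \<open>b\<^sub>i\<close>, taking the value 1 there gives a unitriangular family. The relations among the
  \<open>a\<^sub>n\<close> then become a triangular linear system for the \<open>d\<^sub>n\<close>, which is solvable over the integers
  (lemma \<open>gram_entry_solves\<close>) and is reduced modulo \<open>p\<close>. As the \<open>c\<^sub>n\<close> and the \<open>e\<^sub>n\<close> are both
  unitriangular, the labelled classes and the center generate the whole group (lemma
  \<open>heisenberg_subgroup_eq_carrier\<close>).
\<close>


section \<open>Pairing up the vertices of the Rado graph\<close>

lemma adjacent_commute: "adjacent G u v \<longleftrightarrow> adjacent G v u"
  by (simp add: adjacent_def insert_commute)

lemma simple_graph_not_adjacent_self: "simple_graph G \<Longrightarrow> \<not> adjacent G v v"
  unfolding simple_graph_def adjacent_def by (fastforce simp: doubleton_eq_iff)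

text \<open>
  The vertices before stage \<open>n\<close> form a finite set \<open>D n\<close>. Stage \<open>n\<close> takes as \<open>a n\<close> the first vertex of
  a fixed enumeration that is still missing, so that every vertex is reached, and then uses the
  extension property once, with \<open>U = D n\<close> and \<open>W = {a n}\<close>, to find \<open>b n\<close>.
\<close>

lemma rado_graph_pairing:
  assumes "rado_graph G"
  obtains a b :: "nat \<Rightarrow> 'v"
  where "bij_betw (case_sum a b) UNIV (vertices G)"
    and "\<And>n. \<not> adjacent G (a n) (b n)"
    and "\<And>m n. m < n \<Longrightarrow> adjacent G (a m) (b n)"
    and "\<And>m n. m < n \<Longrightarrow> adjacent G (b m) (b n)"
proof -
  let ?V = "vertices G"
  let ?e = "from_nat_into ?V"
  have inf: "infinite ?V" and cnt: "countable ?V"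
    and ext: "\<And>U W. finite U \<Longrightarrow> finite W \<Longrightarrow> U \<subseteq> ?V \<Longrightarrow> W \<subseteq> ?V \<Longrightarrow> U \<inter> W = {} \<Longrightarrow>
      \<exists>v\<in>?V - (U \<union> W). (\<forall>u\<in>U. adjacent G v u) \<and> (\<forall>w\<in>W. \<not> adjacent G v w)"
    using assms unfolding rado_graph_def by blast+
  have ne: "?V \<noteq> {}" using inf by auto
  have eV: "?e k \<in> ?V" for k using from_nat_into[OF ne] .
  define new where "new A = ?e (LEAST k. ?e k \<notin> A)" for A
  define partner where "partner A = (SOME v. v \<in> ?V - insert (new A) A \<and>
    (\<forall>u\<in>A. adjacent G v u) \<and> \<not> adjacent G v (new A))" for A
  have new: "new A \<in> ?V" "new A \<notin> A" if "finite A" for A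
  proof -
    have "\<exists>k. ?e k \<notin> A"
      using that inf cnt by (metis finite_subset from_nat_into_surj subsetI)
    then show "new A \<notin> A" unfolding new_def by (rule LeastI_ex)
    show "new A \<in> ?V" unfolding new_def by (rule eV)
  qed
  have partner: "partner A \<in> ?V - insert (new A) A \<and>
    (\<forall>u\<in>A. adjacent G (partner A) u) \<and> \<not> adjacent G (partner A) (new A)"
    if "finite A" "A \<subseteq> ?V" for A
  proof -
    have "\<exists>v\<in>?V - (A \<union> {new A}). (\<forall>u\<in>A. adjacent G v u) \<and> (\<forall>w\<in>{new A}. \<not> adjacent G v w)"
      by (rule ext) (use that new[OF that(1)] in auto)
    then show ?thesis unfolding partner_def by - (rule someI_ex, auto)
  qed
  define D where "D = rec_nat {} (\<lambda>_ A. insert (new A) (insert (partner A) A))"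
  have D_0: "D 0 = {}" and D_Suc: "D (Suc n) = insert (new (D n)) (insert (partner (D n)) (D n))" for n
    by (simp_all add: D_def)
  have D: "finite (D n) \<and> D n \<subseteq> ?V" for n
    by (induction n) (use new partner in \<open>auto simp: D_0 D_Suc\<close>)
  have D_mono: "D m \<subseteq> D n" if "m \<le> n" for m n
    using that by (induction n rule: dec_induct) (auto simp: D_Suc)
  define a where "a n = new (D n)" for n
  define b where "b n = partner (D n)" for n
  have D_less: "a m \<in> D n" "b m \<in> D n" if "m < n" for m n
    using D_mono[of "Suc m" n] that by (auto simp: D_Suc a_def b_def)
  have a: "a n \<in> ?V" "a n \<notin> D n" for n
    using new[of "D n"] D by (auto simp: a_def)
  have b: "b n \<in> ?V" "b n \<notin> D n" "b n \<noteq> a n" "\<And>u. u \<in> D n \<Longrightarrow> adjacent G u (b n)"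
    "\<not> adjacent G (a n) (b n)" for n
    using partner[of "D n"] D[of n] by (auto simp: a_def b_def adjacent_commute)
  have e_D: "?e ` {..<n} \<subseteq> D n" for n
  proof (induction n)
    case (Suc n)
    have "?e n \<in> D (Suc n)"
    proof (cases "?e n \<in> D n")
      case False
      have "(LEAST k. ?e k \<notin> D n) = n"
        by (rule Least_equality) (use False Suc in \<open>auto simp: image_subset_iff leI not_less\<close>)
      then show ?thesis by (simp add: D_Suc new_def)
    qed (simp add: D_Suc)
    then show ?case using Suc by (auto simp: D_Suc lessThan_Suc)
  qed simp
  have D_range: "D n \<subseteq> range a \<union> range b" for n
    by (induction n) (auto simp: D_0 D_Suc a_def b_def)
  have ab: "a m \<noteq> b n" for m n
    using a(2)[of m] b(2)[of n] b(3)[of n] D_less(1)[of m n] D_less(2)[of n m]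
    by (cases m n rule: linorder_cases) auto
  have "inj a" by (rule linorder_injI) (use a(2) D_less(1) in metis)
  moreover have "inj b" by (rule linorder_injI) (use b(2) D_less(2) in metis)
  ultimately have "inj (case_sum a b)"
    using ab ab[symmetric] by (auto simp: inj_def split: sum.splits)
  moreover have "range (case_sum a b) = ?V"
  proof
    show "range (case_sum a b) \<subseteq> ?V" using a b by (auto split: sum.splits)
    show "?V \<subseteq> range (case_sum a b)"
    proof
      fix v assume "v \<in> ?V"
      then obtain k where "v = ?e k" using cnt by (metis from_nat_into_surj)
      then have "v \<in> range a \<union> range b" using e_D[of "Suc k"] D_range by blast
      then show "v \<in> range (case_sum a b)"
        by (auto intro: range_eqI[of _ _ "Inl _"] range_eqI[of _ _ "Inr _"])
    qed
  qed
  ultimately have "bij_betw (case_sum a b) UNIV ?V" by (simp add: bij_betw_def)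
  then show thesis
    using b(5) b(4)[OF D_less(1)] b(4)[OF D_less(2)] by (rule that)
qed


section \<open>Prescribing a symplectic Gram matrix\<close>

text \<open>
  For rows \<open>c n\<close> that are unitriangular, rows \<open>d n\<close> supported strictly below \<open>n\<close> are to satisfy
  \<open>c n \<cdot> d m - c m \<cdot> d n = g n m\<close> for \<open>m < n\<close>. In this equation \<open>d n m\<close> occurs with coefficient
  \<open>- c m m = - 1\<close>, and every other entry of \<open>d\<close> that occurs is \<open>d m l\<close> or \<open>d n l\<close> with \<open>l < m\<close>.
  Solving for \<open>d n m\<close> therefore is a recursion along the lexicographic order of the index pairs.
  No division occurs, so the solution exists over the integers.
\<close>

fun gram_entry :: "(nat \<Rightarrow> nat \<Rightarrow> int) \<Rightarrow> (nat \<Rightarrow> nat \<Rightarrow> int) \<Rightarrow> nat \<Rightarrow> nat \<Rightarrow> int" where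
  "gram_entry c g n m =
     (if m < n
      then (\<Sum>l<m. c n l * gram_entry c g m l) - (\<Sum>l<m. c m l * gram_entry c g n l) - g n m
      else 0)"

declare gram_entry.simps [simp del]

lemma gram_entry_eq_0: "n \<le> m \<Longrightarrow> gram_entry c g n m = 0"
  by (simp add: gram_entry.simps)

lemma gram_entry_solves:
  assumes diag: "c m m = 1" and "m < n"
  shows "(\<Sum>l\<le>n. c n l * gram_entry c g m l) - (\<Sum>l\<le>m. c m l * gram_entry c g n l) = g n m"
proof -
  have "(\<Sum>l\<le>n. c n l * gram_entry c g m l) = (\<Sum>l<m. c n l * gram_entry c g m l)"
    by (rule sum.mono_neutral_right) (use \<open>m < n\<close> in \<open>auto simp: gram_entry_eq_0\<close>)
  moreover have "(\<Sum>l\<le>m. c m l * gram_entry c g n l) =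
      (\<Sum>l<m. c m l * gram_entry c g n l) + gram_entry c g n m"
    by (simp add: lessThan_Suc_atMost[symmetric] diag)
  ultimately show ?thesis
    using \<open>m < n\<close> gram_entry.simps[of c g n m] by simp
qed


section \<open>Graphs realized by classes of the Heisenberg group\<close>

definition heisenberg_class ::
    "('a, 'b) ring_scheme \<Rightarrow> (nat \<Rightarrow> 'a) \<times> (nat \<Rightarrow> 'a) \<Rightarrow> ((nat \<Rightarrow> 'a) \<times> (nat \<Rightarrow> 'a) \<times> 'a) set" where
  "heisenberg_class R w = {(fst w, snd w, z) | z. z \<in> carrier R}"

context field
begin

text \<open>
  A labelling of a graph by vectors carries over to an isomorphism because the map from vectors to
  classes is injective, and because classes are pairwise disjoint: a union of classes contains no
  class besides the ones it was formed from.
\<close>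

lemma heisenberg_realizes_graph:
  fixes w :: "'i \<Rightarrow> (nat \<Rightarrow> 'a) \<times> (nat \<Rightarrow> 'a)"
  assumes e: "bij_betw e I (vertices G)" and inj: "inj_on w I"
    and w: "\<And>i. i \<in> I \<Longrightarrow> w i \<in> fin_seqs R \<times> fin_seqs R - {(\<lambda>i. \<zero>, \<lambda>i. \<zero>)}"
    and adj: "\<And>i j. i \<in> I \<Longrightarrow> j \<in> I \<Longrightarrow> adjacent G (e i) (e j) \<longleftrightarrow>
      i \<noteq> j \<and> dot R (fst (w i)) (snd (w j)) = dot R (fst (w j)) (snd (w i))"
  defines "S \<equiv> \<Union>i\<in>I. heisenberg_class R (w i)"
  shows "S \<subseteq> carrier (heisenberg_over R)"
    and "union_of_classes (heisenberg_over R) S"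
    and "graph_isomorphic (class_subgraph (heisenberg_over R) S) G"
proof -
  let ?H = "heisenberg_over R"
  let ?\<Gamma> = "class_subgraph ?H S"
  let ?C = "\<lambda>i. heisenberg_class R (w i)"
  have "noncentral_classes ?H = {heisenberg_class R (x, y) | x y.
      x \<in> fin_seqs R \<and> y \<in> fin_seqs R \<and> (x, y) \<noteq> (\<lambda>i. \<zero>, \<lambda>i. \<zero>)}"
    by (simp only: heisenberg_noncentral_classes heisenberg_class_def fst_conv snd_conv)
  then have noncentral: "noncentral_classes ?H =
      heisenberg_class R ` (fin_seqs R \<times> fin_seqs R - {(\<lambda>i. \<zero>, \<lambda>i. \<zero>)})"
    by blast
  have mem: "(x, y, z) \<in> heisenberg_class R v \<longleftrightarrow> (x, y) = v \<and> z \<in> carrier R" for x y z v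
    by (cases v) (auto simp: heisenberg_class_def)
  have class_eqD: "v = v'" if "heisenberg_class R v \<subseteq> heisenberg_class R v'" for v v'
    using that mem[of "fst v" "snd v" \<zero> v] mem[of "fst v" "snd v" \<zero> v'] by auto
  show "S \<subseteq> carrier ?H"
    using w by (fastforce simp: S_def mem heisenberg_carrier)
  show "union_of_classes ?H S"
    unfolding union_of_classes_def S_def
    by (intro exI[of _ "?C ` I"]) (use w noncentral in \<open>auto simp: noncentral_classes_def\<close>)
  have sub_S: "heisenberg_class R v \<subseteq> S \<longleftrightarrow> v \<in> w ` I" for v
  proof
    assume "heisenberg_class R v \<subseteq> S"
    then have "(fst v, snd v, \<zero>) \<in> S" using mem[of "fst v" "snd v" \<zero> v] by auto
    then show "v \<in> w ` I" by (auto simp: S_def mem)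
  qed (auto simp: S_def)
  have "vertices ?\<Gamma> = {C \<in> noncentral_classes ?H. C \<subseteq> S}"
    by (auto simp: class_subgraph_def induced_subgraph_def class_graph_def)
  also have "\<dots> = heisenberg_class R ` (w ` I)"
    unfolding noncentral Compr_image_eq sub_S Collect_conj_eq Collect_mem_eq
    using image_subsetI[of I w, OF w] by (simp only: Int_absorb1)
  also have "\<dots> = ?C ` I" by (rule image_image)
  finally have vert: "vertices ?\<Gamma> = ?C ` I" .
  have bij: "bij_betw ?C I (vertices ?\<Gamma>)"
    unfolding bij_betw_def vert using class_eqD inj by (auto simp: inj_on_def)
  have adj': "adjacent ?\<Gamma> (?C i) (?C j) \<longleftrightarrow> adjacent G (e i) (e j)" if "i \<in> I" "j \<in> I" for i j
  proof -
    obtain x y x' y' where ij: "w i = (x, y)" "w j = (x', y')" by (meson surj_pair)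
    have cl: "dot R x y' \<in> carrier R" "dot R x' y \<in> carrier R"
      using w[OF that(1)] w[OF that(2)] ij by (auto simp: dot_closed)
    have "adjacent ?\<Gamma> (?C i) (?C j) \<longleftrightarrow> adjacent (class_graph ?H) (?C i) (?C j)"
      using that by (simp add: adjacent_def class_subgraph_def induced_subgraph_def sub_S)
    also have "\<dots> \<longleftrightarrow> (x, y) \<noteq> (x', y') \<and> dot R x y' \<ominus> dot R x' y = \<zero>"
      unfolding heisenberg_class_def ij fst_conv snd_conv
      by (rule heisenberg_class_graph_adjacent) (use w[OF that(1)] w[OF that(2)] ij in auto)
    also have "\<dots> \<longleftrightarrow> i \<noteq> j \<and> dot R x y' = dot R x' y"
      using cl that inj by (auto simp flip: ij simp: inj_on_eq_iff)
    finally show ?thesis using adj[OF that] ij by simp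
  qed
  show "graph_isomorphic ?\<Gamma> G"
    unfolding graph_isomorphic_def
  proof (intro exI conjI ballI)
    show "bij_betw (e \<circ> inv_into I ?C) (vertices ?\<Gamma>) (vertices G)"
      using bij_betw_trans[OF bij_betw_inv_into[OF bij] e] .
    fix C D assume "C \<in> vertices ?\<Gamma>" "D \<in> vertices ?\<Gamma>"
    then obtain i j where "i \<in> I" "j \<in> I" "C = ?C i" "D = ?C j" unfolding vert by auto
    then show "adjacent ?\<Gamma> C D \<longleftrightarrow>
        adjacent G ((e \<circ> inv_into I ?C) C) ((e \<circ> inv_into I ?C) D)"
      using adj' bij_betw_inv_into_left[OF bij] by simp
  qed
qed

end


section \<open>Generation from triangular families over residue rings\<close>

context residues
begin

lemma mod_fin_seqs:
  assumes "finite {i. x i \<noteq> 0}"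
  shows "(\<lambda>i. x i mod m) \<in> fin_seqs R"
  using assms unfolding fin_seqs_def
  by (auto simp: res_zero_eq intro: finite_subset[of _ "{i. x i \<noteq> 0}"])

lemma dot_mod:
  assumes "finite {i. x i \<noteq> 0}" "finite {i. y i \<noteq> 0}" "finite A" "{i. x i \<noteq> 0} \<subseteq> A"
  shows "dot R (\<lambda>i. x i mod m) (\<lambda>i. y i mod m) = (\<Sum>i\<in>A. x i * y i) mod m"
proof -
  have "dot R (\<lambda>i. x i mod m) (\<lambda>i. y i mod m) = (\<Oplus>i\<in>A. (x i mod m) \<otimes> (y i mod m))"
    by (rule dot_superset) (use assms in \<open>auto simp: mod_fin_seqs res_zero_eq\<close>)
  also have "\<dots> = (\<Sum>i\<in>A. x i * y i) mod m"
    using assms by (simp add: mult_cong sum_cong)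
  finally show ?thesis .
qed

text \<open>
  Every finitely supported sequence is a sum of members of a unitriangular family: subtracting
  \<open>u n\<close> lowers the top coordinate \<open>x n\<close> by 1, and once it is 0 the support has become shorter.
  Repeated addition replaces scalar multiplication here, which is possible because 1 generates the
  additive group of a residue ring.
\<close>

lemma fin_seqs_unitriangular_induct [consumes 1, case_names fin_seqs diag above zero add]:
  assumes "x \<in> fin_seqs R"
    and u: "\<And>n. u n \<in> fin_seqs R" "\<And>n. u n n = \<one>" "\<And>n i. n < i \<Longrightarrow> u n i = \<zero>"
    and zero: "Q (\<lambda>i. \<zero>)"
    and add: "\<And>x n. x \<in> fin_seqs R \<Longrightarrow> Q x \<Longrightarrow> Q (\<lambda>i. x i \<oplus> u n i)"
  shows "Q x"
proof -
  have *: "Q x" if "x \<in> fin_seqs R" "\<And>i. n \<le> i \<Longrightarrow> x i = \<zero>" for x n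
    using that
  proof (induction n arbitrary: x)
    case 0
    then have "x = (\<lambda>i. \<zero>)" by auto
    then show ?case using zero by simp
  next
    case (Suc n)
    have "Q x" if "x \<in> fin_seqs R" "\<And>i. Suc n \<le> i \<Longrightarrow> x i = \<zero>" "x n = int k" for x k
      using that
    proof (induction k arbitrary: x)
      case 0
      have "x i = \<zero>" if "n \<le> i" for i
        using 0 that by (cases "i = n") (simp_all add: res_zero_eq)
      then show ?case using 0 Suc.IH by simp
    next
      case (Suc k)
      \<comment> \<open>The top coordinate stays in the range of canonical representatives, so lowering it by 1
        modulo \<open>m\<close> is the predecessor of natural numbers.\<close>
      let ?x = "\<lambda>i. x i \<oplus> \<ominus> u n i"
      have x: "x i \<in> carrier R" for i using Suc.prems fin_seqsD by auto
      have u': "u n i \<in> carrier R" for i using u fin_seqsD by auto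
      have "?x \<in> fin_seqs R" using Suc.prems u by (intro add_fin_seqs uminus_fin_seqs) auto
      moreover have "?x i = \<zero>" if "Suc n \<le> i" for i
        using Suc.prems(2)[OF that] u(3)[of n i] that by auto
      moreover have "?x n = int k"
      proof -
        have "int k < m" using x[of n] Suc.prems(3) by (auto simp: res_carrier_eq)
        then show ?thesis
          using Suc.prems(3) u(2)[of n] by (simp add: res_neg_eq res_add_eq res_one_eq mod_simps)
      qed
      ultimately have "Q ?x" by (rule Suc.IH)
      then have "Q (\<lambda>i. ?x i \<oplus> u n i)" using \<open>?x \<in> fin_seqs R\<close> by (rule add[rotated])
      moreover have "(\<lambda>i. ?x i \<oplus> u n i) = x"
        using x u' by (simp add: a_assoc l_neg)
      ultimately show ?case by simp
    qed
    moreover have "x n = int (nat (x n))"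
      using fin_seqsD[OF Suc.prems(1), of n] by (simp add: res_carrier_eq)
    ultimately show ?case using Suc.prems by metis
  qed
  have "finite {i. x i \<noteq> \<zero>}" using assms(1) by (simp add: fin_seqs_def)
  then obtain n where "\<forall>i\<in>{i. x i \<noteq> \<zero>}. i < n" using finite_nat_set_iff_bounded by auto
  then show ?thesis using * assms(1) by (metis (mono_tags, lifting) leD mem_Collect_eq)
qed

text \<open>
  The second components are produced first: the elements \<open>(0, s, z)\<close> multiply without a correction
  term. For the first components, the second one is kept universally quantified in the induction, so
  that the unknown \<open>y n\<close> attached to \<open>u n\<close> is harmless.
\<close>

lemma heisenberg_subgroup_eq_carrier:
  assumes T: "subgroup T (heisenberg_over R)"
    and center: "\<And>z. z \<in> carrier R \<Longrightarrow> (\<lambda>i. \<zero>, \<lambda>i. \<zero>, z) \<in> T"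
    and v: "\<And>n. (\<lambda>i. \<zero>, v n, \<zero>) \<in> T" "\<And>n. v n n = \<one>" "\<And>n i. n < i \<Longrightarrow> v n i = \<zero>"
    and u: "\<And>n. (u n, y n, \<zero>) \<in> T" "\<And>n. u n n = \<one>" "\<And>n i. n < i \<Longrightarrow> u n i = \<zero>"
  shows "T = carrier (heisenberg_over R)"
proof -
  note T_mult = subgroup.m_closed[OF T]
  have v_fin: "v n \<in> fin_seqs R" for n
    using subgroup.mem_carrier[OF T v(1)[of n]] by (simp add: heisenberg_carrier)
  have u_fin: "u n \<in> fin_seqs R" "y n \<in> fin_seqs R" for n
    using subgroup.mem_carrier[OF T u(1)[of n]] by (simp_all add: heisenberg_carrier)
  have T0: "\<forall>z\<in>carrier R. (\<lambda>i. \<zero>, s, z) \<in> T" if "s \<in> fin_seqs R" for s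
    using that
  proof (induction s rule: fin_seqs_unitriangular_induct[where u = v])
    case (add s n)
    show ?case
    proof
      fix z assume "z \<in> carrier R"
      then show "(\<lambda>i. \<zero>, \<lambda>i. s i \<oplus> v n i, z) \<in> T"
        using T_mult[OF _ v(1)[of n], of "(\<lambda>i. \<zero>, s, z)"] add
        by (simp add: heisenberg_mult)
    qed
  qed (use v v_fin center in auto)
  have T1: "\<forall>s\<in>fin_seqs R. \<forall>z\<in>carrier R. (r, s, z) \<in> T" if "r \<in> fin_seqs R" for r
    using that
  proof (induction r rule: fin_seqs_unitriangular_induct[where u = u])
    case (add r n)
    show ?case
    proof (intro ballI)
      fix s z assume s: "s \<in> fin_seqs R" and z: "z \<in> carrier R"
      \<comment> \<open>The left factor anticipates both \<open>y n\<close> and the cocycle value \<open>r \<cdot> y n\<close> that multiplying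
        by \<open>(u n, y n, 0)\<close> from the right adds.\<close>
      let ?s = "\<lambda>i. s i \<oplus> \<ominus> y n i" and ?d = "dot R r (y n)"
      have s': "?s \<in> fin_seqs R" using s u_fin by (intro add_fin_seqs uminus_fin_seqs)
      have d: "?d \<in> carrier R" using add u_fin by (intro dot_closed)
      have "(r, ?s, z \<oplus> \<ominus> ?d) \<otimes>\<^bsub>heisenberg_over R\<^esub> (u n, y n, \<zero>) \<in> T"
        using add s' z d u(1) by (intro T_mult) auto
      moreover have "(\<lambda>i. ?s i \<oplus> y n i) = s"
        using s u_fin by (simp add: a_assoc l_neg fin_seqsD)
      ultimately show "(\<lambda>i. r i \<oplus> u n i, s, z) \<in> T"
        using z d by (simp add: heisenberg_mult a_assoc l_neg)
    qed
  qed (use u u_fin T0 in auto)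
  show ?thesis
    using subgroup.subset[OF T] T1 by (auto simp: heisenberg_carrier)
qed

end


section \<open>The infinite Heisenberg group over the Rado graph\<close>

theorem theorem4p9:
  fixes p :: nat and Rado :: "'v ugraph"
  assumes "prime p" and "odd p" and "rado_graph Rado"
  shows "\<exists>S. S \<subseteq> carrier (heisenberg p) \<and>
           union_of_classes (heisenberg p) S \<and>
           graph_isomorphic (class_subgraph (heisenberg p) S) Rado \<and>
           generate (heisenberg p) (S \<union> group_center (heisenberg p)) = carrier (heisenberg p)"
proof -
  let ?adj = "adjacent Rado"
  obtain a b :: "nat \<Rightarrow> 'v" where bij: "bij_betw (case_sum a b) UNIV (vertices Rado)"
    and nadj: "\<And>n. \<not> ?adj (a n) (b n)"
    and adj_ab: "\<And>m n. m < n \<Longrightarrow> ?adj (a m) (b n)"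
    and adj_bb: "\<And>m n. m < n \<Longrightarrow> ?adj (b m) (b n)"
    using rado_graph_pairing[OF assms(3)] by blast
  have irrefl: "\<not> ?adj v v" for v
    using assms(3) by (simp add: rado_graph_def simple_graph_not_adjacent_self)
  define R where "R = residue_ring (int p)"
  interpret residues_prime p R
    by unfold_locales (simp_all add: assms(1) R_def)
  interpret H: group "heisenberg_over R" by (rule heisenberg_group)
  have p1: "1 < int p" by (rule m_gt_one)

  \<comment> \<open>\<open>Inl n\<close> indexes \<open>a n\<close> with label \<open>(c n, d n)\<close>, and \<open>Inr n\<close> indexes \<open>b n\<close> with label
    \<open>(0, unit n)\<close>. The entry \<open>c n i\<close> is the value of the symplectic form on \<open>a n\<close> and \<open>b i\<close>, and
    \<open>g n k\<close> is the value prescribed for \<open>a n\<close> and \<open>a k\<close>.\<close>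
  define c :: "nat \<Rightarrow> nat \<Rightarrow> int" where "c n i = of_bool (\<not> ?adj (a n) (b i))" for n i
  define g :: "nat \<Rightarrow> nat \<Rightarrow> int" where "g n k = of_bool (\<not> ?adj (a n) (a k))" for n k
  define d where "d = gram_entry c g"
  define unit :: "nat \<Rightarrow> nat \<Rightarrow> int" where "unit n i = of_bool (i = n)" for n i
  define x y :: "nat + nat \<Rightarrow> nat \<Rightarrow> int" where "x = case_sum c (\<lambda>n i. 0)" and "y = case_sum d unit"
  define w where "w k = ((\<lambda>i. x k i mod int p), (\<lambda>i. y k i mod int p))" for k
  have c_diag: "c n n = 1" and c_above: "n < i \<Longrightarrow> c n i = 0" for n i
    using nadj adj_ab by (auto simp: c_def)
  have c_supp: "{i. c n i \<noteq> 0} \<subseteq> {..n}" for n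
    using c_above by (force simp: not_le[symmetric])
  have d_supp: "{i. d n i \<noteq> 0} \<subseteq> {..<n}" for n
    unfolding d_def using gram_entry_eq_0 by (force simp: not_le[symmetric])
  have fin: "finite {i. x k i \<noteq> 0}" "finite {i. y k i \<noteq> 0}" for k
    using finite_subset[OF c_supp] finite_subset[OF d_supp]
    by (cases k; simp add: x_def y_def unit_def)+
  have w_fin: "fst (w k) \<in> fin_seqs R" "snd (w k) \<in> fin_seqs R" for k
    using fin by (simp_all add: w_def mod_fin_seqs)

  have dot_a: "dot R (fst (w (Inl n))) (snd (w k)) = (\<Sum>i\<le>n. c n i * y k i) mod int p" for n k
    using dot_mod[OF fin(1)[of "Inl n"] fin(2)[of k], of "{..n}"] c_supp[of n]
    by (simp add: w_def x_def)
  have dot_b: "dot R (fst (w (Inr n))) (snd (w k)) = 0" for n k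
    using dot_zero_left[of "snd (w k)"] by (simp add: w_def x_def res_zero_eq)
  have dot_ab: "dot R (fst (w (Inl n))) (snd (w (Inr k))) = of_bool (\<not> ?adj (a n) (b k))" for n k
  proof -
    have "(\<Sum>i\<le>n. c n i * unit k i) = c n k"
      using c_above[of n k] by (cases "k \<le> n") (simp_all add: unit_def)
    then show ?thesis using p1 by (simp add: dot_a y_def c_def)
  qed
  have dot_aa: "dot R (fst (w (Inl n))) (snd (w (Inl k))) = dot R (fst (w (Inl k))) (snd (w (Inl n)))
      \<longleftrightarrow> ?adj (a n) (a k)" if "k < n" for n k
  proof -
    have "(\<Sum>i\<le>n. c n i * d k i) - (\<Sum>i\<le>k. c k i * d n i) = g n k"
      unfolding d_def using gram_entry_solves[of c k n g] c_diag that by simp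
    then have "(\<Sum>i\<le>n. c n i * d k i) mod int p = (\<Sum>i\<le>k. c k i * d n i) mod int p \<longleftrightarrow>
        int p dvd g n k"
      by (simp add: mod_eq_dvd_iff)
    also have "\<dots> \<longleftrightarrow> ?adj (a n) (a k)"
      using p1 by (auto simp: g_def)
    finally show ?thesis by (simp add: dot_a y_def)
  qed
  have adj: "?adj (case_sum a b k) (case_sum a b l) \<longleftrightarrow>
      k \<noteq> l \<and> dot R (fst (w k)) (snd (w l)) = dot R (fst (w l)) (snd (w k))" for k l
  proof (cases k; cases l)
    fix n n' assume kl: "k = Inl n" "l = Inl n'"
    show ?thesis
      using dot_aa[of n n'] dot_aa[of n' n] irrefl kl
      by (cases n n' rule: linorder_cases) (auto simp: adjacent_commute)
  next
    fix n n' assume kl: "k = Inr n" "l = Inr n'"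
    show ?thesis
      using adj_bb[of n n'] adj_bb[of n' n] irrefl kl dot_b
      by (cases n n' rule: linorder_cases) (auto simp: adjacent_commute)
  next
    fix n n' assume "k = Inl n" "l = Inr n'"
    then show ?thesis by (simp add: dot_ab dot_b)
  next
    fix n n' assume "k = Inr n" "l = Inl n'"
    then show ?thesis by (auto simp: dot_ab dot_b adjacent_commute)
  qed

  have unit_mod: "unit n i mod int p = unit n i" and c_mod: "c n i mod int p = c n i" for n i
    using p1 by (simp_all add: unit_def c_def)
  have inj: "inj w"
  proof (rule injI)
    fix k l assume eq: "w k = w l"
    then have x_eq: "x k i mod int p = x l i mod int p"
      and y_eq: "y k i mod int p = y l i mod int p" for i
      by (auto simp: w_def fun_eq_iff)
    show "k = l"
    proof (cases k; cases l)
      fix n n' assume kl: "k = Inl n" "l = Inl n'"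
      then have "c n i = c n' i" for i using x_eq[of i] by (simp add: x_def c_mod)
      then have "n = n'" using c_diag c_above by (metis linorder_cases zero_neq_one)
      then show ?thesis using kl by simp
    next
      fix n n' assume kl: "k = Inr n" "l = Inr n'"
      then have "unit n i = unit n' i" for i using y_eq[of i] by (simp add: y_def unit_mod)
      from this[of n] show ?thesis using kl by (auto simp: unit_def split: if_splits)
    next
      fix n n' assume kl: "k = Inl n" "l = Inr n'"
      then show ?thesis using x_eq[of n] p1 by (simp add: x_def c_diag)
    next
      fix n n' assume kl: "k = Inr n" "l = Inl n'"
      then show ?thesis using x_eq[of n'] p1 by (simp add: x_def c_diag)
    qed
  qed
  have w_a: "w (Inl n) = (c n, \<lambda>i. d n i mod int p)" and w_b: "w (Inr n) = (\<lambda>i. 0, unit n)" for n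
    by (simp_all add: w_def x_def y_def c_mod unit_mod)
  have nz: "w k \<noteq> (\<lambda>i. \<zero>\<^bsub>R\<^esub>, \<lambda>i. \<zero>\<^bsub>R\<^esub>)" for k
  proof (cases k)
    case (Inl n)
    then show ?thesis using c_diag[of n] by (auto simp: w_a res_zero_eq)
  next
    case (Inr n)
    have "unit n n = 1" by (simp add: unit_def)
    then have "unit n \<noteq> (\<lambda>i. 0)" by auto
    then show ?thesis using Inr by (simp add: w_b res_zero_eq)
  qed
  have w_mem: "w k \<in> fin_seqs R \<times> fin_seqs R - {(\<lambda>i. \<zero>\<^bsub>R\<^esub>, \<lambda>i. \<zero>\<^bsub>R\<^esub>)}" for k
    using w_fin[of k] nz[of k] by (simp add: mem_Times_iff)

  let ?S = "\<Union>k\<in>UNIV. heisenberg_class R (w k)"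
  let ?T = "generate (heisenberg_over R) (?S \<union> group_center (heisenberg_over R))"
  note S = heisenberg_realizes_graph[OF bij inj w_mem adj]
  have S_T: "(fst (w k), snd (w k), \<zero>\<^bsub>R\<^esub>) \<in> ?T" for k
    by (rule generate.incl) (auto simp: heisenberg_class_def)
  have "?T = carrier (heisenberg_over R)"
  proof (rule heisenberg_subgroup_eq_carrier[where v = unit and u = c
        and y = "\<lambda>n i. d n i mod int p"])
    show "subgroup ?T (heisenberg_over R)"
      by (rule H.generate_is_subgroup) (use S(1) in \<open>auto simp: group_center_def\<close>)
    show "(\<lambda>i. \<zero>\<^bsub>R\<^esub>, \<lambda>i. \<zero>\<^bsub>R\<^esub>, z) \<in> ?T" if "z \<in> carrier R" for z
      by (rule generate.incl) (use that in \<open>auto simp: heisenberg_center\<close>)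
    show "(\<lambda>i. \<zero>\<^bsub>R\<^esub>, unit n, \<zero>\<^bsub>R\<^esub>) \<in> ?T" for n
      using S_T[of "Inr n"] by (simp add: w_b res_zero_eq)
    show "(c n, \<lambda>i. d n i mod int p, \<zero>\<^bsub>R\<^esub>) \<in> ?T" for n
      using S_T[of "Inl n"] by (simp add: w_a)
  qed (simp_all add: unit_def c_diag c_above res_one_eq res_zero_eq)
  then show ?thesis
    unfolding heisenberg_def R_def[symmetric] using S by (intro exI[of _ ?S]) simp
qed

end
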